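(* Let $M$ be an episodic MDP and let $\mathcal F\subset\mathcal G$ be classes of action-value functions such that $\mathcal F$ has low $D_\Delta$-type Bellman eluder dimension with auxiliary (complete) class $\mathcal G$. Put $\zeta_h=\{s_{h+1}\}$, $\eta_h=\{s_h,a_h\}$, $\kappa=1$, $d=d_{BE}(\mathcal F,D_\Delta,1/\sqrt K)$ and $$\ell_{h,f'}(\zeta_h,\eta_h,f,g)=Q_{h,g}(s_h,a_h)-r_h(s_h,a_h)-V_{h+1,f}(s_{h+1}).$$ Then $(M,\mathcal F,\mathcal G,\ell,d,\kappa)$ is an $\ell_2$-type EC class (with $R=3$). In particular, for each $h\in[H]$ and $\beta\ge9$: if $f^1,\dots,f^K\in\mathcal F$ and state-action pairs $(s_h^i,a_h^i)_{i\in[K]}$ satisfy $\sum_{i=1}^{k-1}\mathcal E_h(f^k,s_h^i,a_h^i)^2\le\beta$ for all $k\in[K]$, then for all $k\in[K]$ $$\sum_{i=1}^k\mathcal E_h(f^i,s_h^i,a_h^i)^2\le\mathcal O(d\beta\log K),$$ and the $\kappa$-dominance property holds with $\kappa=1$.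
   Context: **Model.** An episodic MDP $(\mathcal S,\mathcal A,H,\mathbb P,r)$ has transition kernels $\mathbb P_h$, deterministic rewards $r_h$, fixed initial state $s_1$, total reward in $[0,1]$ along every trajectory. $\mathcal F=\mathcal F_1\times\dots\times\mathcal F_H$; $f\in\mathcal F$ gives $Q_{h,f}=f_h$, $V_{h,f}(s)=\max_aQ_{h,f}(s,a)$ (with $V_{H+1,f}=0$), and greedy policy $\pi_f$. Functions are bounded so that all losses/Bellman residuals are bounded by $R=3$. Realizability: some $f^*\in\mathcal F$ has $Q_{h,f^*}=Q_h^*$ for all $h$. Bellman operator: $(\mathcal T_hf_{h+1})(s,a)=r_h(s,a)+\mathbb E_{s'\sim\mathbb P_h(\cdot\mid s,a)}\max_{a'}f_{h+1}(s',a')$; completeness with auxiliary class: $\mathcal T_h\mathcal F_{h+1}\subset\mathcal G_h$. Bellman residual: $\mathcal E_h(f,s,a)=(f_h-\mathcal T_hf_{h+1})(s,a)$. **$D_\Delta$-type Bellman eluder dimension.** $d_{BE}(\mathcal F,D_\Delta,\varepsilon)$ is the maximum over $h\in[H]$ of the length $n$ of the longest sequence $(s_h^1,a_h^1),\dots,(s_h^n,a_h^n)$ such that for some $\varepsilon'\ge\varepsilon$ and every $j\in[n]$ there is $f^j\in\mathcal F$ with $\sqrt{\sum_{i=1}^{j-1}\mathcal E_h(f^j,s_h^i,a_h^i)^2}\le\varepsilon'$ and $|\mathcal E_h(f^j,s_h^j,a_h^j)|>\varepsilon'$. **$\ell_2$-type EC class.** With $\mathbb E_{\zeta_h}$ the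 expectation over $s_{h+1}\sim\mathbb P_h(\cdot\mid\eta_h)$ and $\|\ell\|_2\le R$, $(M,\mathcal F,\mathcal G,\ell,d,\kappa)$ (where $\mathcal F\subset\mathcal G$ are realizable) is an $\ell_2$-type EC class if for every $\beta\ge R^2$ and $h\in[H]$: (i) whenever $\sum_{i=1}^{k-1}\|\mathbb E_{\zeta_h}[\ell_{h,f^i}(\zeta_h,\eta_h^i,f^k,f^k)]\|_2^2\le\beta$ for all $k\in[K]$, then $\sum_{i=1}^k\|\mathbb E_{\zeta_h}[\ell_{h,f^i}(\zeta_h,\eta_h^i,f^i,f^i)]\|_2^2\le\mathcal O(d\beta\log k)$ for all $k\in[K]$ (here understood with $\log K$ on the right-hand side; $\mathcal O$ hides absolute constants and $R$); (ii) ($\kappa$-dominance) for any $k\in[K]$, with probability at least $1-\delta$, $\sum_{i=1}^k(V_{1,f^i}(s_1)-V_1^{\pi^i}(s_1))\le\kappa\sum_{h=1}^H\sum_{i=1}^k\mathbb E_{\eta_h\sim\pi^i}\|\mathbb E_{\zeta_h}[\ell_{h,f^i}(\zeta_h,\eta_h,f^i,f^i)]\|_2$ with $\pi^i=\pi_{f^i}$. For the loss above, $\mathbb E_{\zeta_h}[\ell_{h,f'}(\zeta_h,\eta_h,f,f)]=\mathcal E_h(f,s_h,a_h)$.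
   Formalization: It is assumed that K ≥ 2 (for K = 1, log K = 0 and the bound fails), and that if d = 0 then all Bellman residuals vanish (otherwise constant sequences with a small nonzero residual violate the bound, whose right side is 0). *)

theory Defs
  imports "HOL-Probability.Probability" "HOL-Library.Extended_Nat"
begin

section \<open>Episodic Markov decision processes\<close>

text \<open>Steps are numbered \<open>1..H\<close>. State and action spaces are measurable spaces whose
  carriers are the whole types.\<close>

record ('s, 'a) mdp =
  states  :: "'s measure"
  actions :: "'a measure"
  horizon :: nat
  trans   :: "nat \<Rightarrow> 's \<times> 'a \<Rightarrow> 's measure"
  reward  :: "nat \<Rightarrow> 's \<times> 'a \<Rightarrow> real"
  init    :: 's

type_synonym ('s, 'a) policy = "nat \<Rightarrow> 's \<Rightarrow> 'a"

type_synonym ('s, 'a) hyp = "nat \<Rightarrow> 's \<times> 'a \<Rightarrow> real"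

definition policies :: "('s, 'a) mdp \<Rightarrow> ('s, 'a) policy set" where
  "policies M = {\<pi>. \<forall>h\<in>{1..horizon M}. \<pi> h \<in> measurable (states M) (actions M)}"

text \<open>\<open>traj_from M \<pi> h s n\<close> is the law of the states \<open>(s\<^sub>h, \<dots>, s\<^sub>h\<^sub>+\<^sub>n)\<close> visited by \<open>\<pi>\<close> when
  \<open>s\<^sub>h = s\<close>. Policies are deterministic, so the action at step \<open>t\<close> of a state trajectory
  \<open>\<omega>\<close> is \<open>\<pi> t (\<omega> t)\<close>.\<close>

primrec traj_from ::
  "('s, 'a) mdp \<Rightarrow> ('s, 'a) policy \<Rightarrow> nat \<Rightarrow> 's \<Rightarrow> nat \<Rightarrow> (nat \<Rightarrow> 's) measure" where
  "traj_from M \<pi> h s 0 =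
     return (PiM {h..h} (\<lambda>_. states M)) (restrict (\<lambda>_. s) {h..h})"
| "traj_from M \<pi> h s (Suc n) =
     traj_from M \<pi> h s n \<bind> (\<lambda>\<omega>.
       distr (trans M (h + n) (\<omega> (h + n), \<pi> (h + n) (\<omega> (h + n))))
         (PiM {h..h + Suc n} (\<lambda>_. states M)) (\<lambda>s'. fun_upd \<omega> (h + Suc n) s'))"

definition traj :: "('s, 'a) mdp \<Rightarrow> ('s, 'a) policy \<Rightarrow> (nat \<Rightarrow> 's) measure" where
  "traj M \<pi> = traj_from M \<pi> 1 (init M) (horizon M - 1)"

text \<open>The bound on the total reward is required almost surely under every policy, so that it
  only concerns trajectories that can occur.\<close>

definition episodic_mdp :: "('s, 'a) mdp \<Rightarrow> bool" where
  "episodic_mdp M \<longleftrightarrow>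
     1 \<le> horizon M \<and>
     space (states M) = UNIV \<and> space (actions M) = UNIV \<and>
     (\<forall>h\<in>{1..horizon M}.
        trans M h \<in> measurable (states M \<Otimes>\<^sub>M actions M) (prob_algebra (states M)) \<and>
        reward M h \<in> borel_measurable (states M \<Otimes>\<^sub>M actions M) \<and>
        bounded (range (reward M h))) \<and>
     (\<forall>\<pi>\<in>policies M. AE \<omega> in traj M \<pi>.
        (\<Sum>h=1..horizon M. reward M h (\<omega> h, \<pi> h (\<omega> h))) \<in> {0..1})"

definition value_pi :: "('s, 'a) mdp \<Rightarrow> ('s, 'a) policy \<Rightarrow> nat \<Rightarrow> 's \<Rightarrow> real" where
  "value_pi M \<pi> h s =
     (\<integral>\<omega>. (\<Sum>t=h..horizon M. reward M t (\<omega> t, \<pi> t (\<omega> t)))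
        \<partial>traj_from M \<pi> h s (horizon M - h))"

definition Q_pi :: "('s, 'a) mdp \<Rightarrow> ('s, 'a) policy \<Rightarrow> nat \<Rightarrow> 's \<times> 'a \<Rightarrow> real" where
  "Q_pi M \<pi> h x = reward M h x + (\<integral>s'. value_pi M \<pi> (h + 1) s' \<partial>trans M h x)"

definition Q_star :: "('s, 'a) mdp \<Rightarrow> nat \<Rightarrow> 's \<times> 'a \<Rightarrow> real" where
  "Q_star M h x = (SUP \<pi>\<in>policies M. Q_pi M \<pi> h x)"

text \<open>\<open>E\<^bsub>\<eta>\<^sub>h \<sim> \<pi>\<^esub>[g(\<eta>\<^sub>h)]\<close>, where \<open>\<eta>\<^sub>h = (s\<^sub>h, a\<^sub>h)\<close>.\<close>

definition expect_pi ::
  "('s, 'a) mdp \<Rightarrow> ('s, 'a) policy \<Rightarrow> nat \<Rightarrow> ('s \<times> 'a \<Rightarrow> real) \<Rightarrow> real" where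
  "expect_pi M \<pi> h g = (\<integral>\<omega>. g (\<omega> h, \<pi> h (\<omega> h)) \<partial>traj M \<pi>)"


section \<open>Hypothesis classes and Bellman residuals\<close>

definition prod_class ::
  "('s, 'a) mdp \<Rightarrow> (nat \<Rightarrow> ('s \<times> 'a \<Rightarrow> real) set) \<Rightarrow> ('s, 'a) hyp set" where
  "prod_class M Fh = (\<Pi>\<^sub>E h\<in>{1..horizon M}. Fh h)"

text \<open>Extended by zero beyond the horizon, which yields the convention \<open>V\<^bsub>H+1,f\<^esub> = 0\<close>.\<close>

definition Qf :: "('s, 'a) mdp \<Rightarrow> ('s, 'a) hyp \<Rightarrow> nat \<Rightarrow> 's \<times> 'a \<Rightarrow> real" where
  "Qf M f h = (if h \<le> horizon M then f h else (\<lambda>_. 0))"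

definition Vf :: "('s, 'a) mdp \<Rightarrow> ('s, 'a) hyp \<Rightarrow> nat \<Rightarrow> 's \<Rightarrow> real" where
  "Vf M f h s = (SUP a. Qf M f h (s, a))"

definition greedy_policy :: "('s, 'a) mdp \<Rightarrow> ('s, 'a) hyp \<Rightarrow> ('s, 'a) policy \<Rightarrow> bool" where
  "greedy_policy M f \<pi> \<longleftrightarrow>
     \<pi> \<in> policies M \<and> (\<forall>h\<in>{1..horizon M}. \<forall>s a. Qf M f h (s, a) \<le> Qf M f h (s, \<pi> h s))"

definition realizable :: "('s, 'a) mdp \<Rightarrow> ('s, 'a) hyp set \<Rightarrow> bool" where
  "realizable M F \<longleftrightarrow> (\<exists>f\<in>F. \<forall>h\<in>{1..horizon M}. Qf M f h = Q_star M h)"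

definition bellman_op ::
  "('s, 'a) mdp \<Rightarrow> nat \<Rightarrow> ('s \<times> 'a \<Rightarrow> real) \<Rightarrow> 's \<times> 'a \<Rightarrow> real" where
  "bellman_op M h q x = reward M h x + (\<integral>s'. (SUP a'. q (s', a')) \<partial>trans M h x)"

definition complete_class ::
  "('s, 'a) mdp \<Rightarrow> ('s, 'a) hyp set \<Rightarrow> (nat \<Rightarrow> ('s \<times> 'a \<Rightarrow> real) set) \<Rightarrow> bool" where
  "complete_class M F Gh \<longleftrightarrow>
     (\<forall>h\<in>{1..horizon M}. \<forall>f\<in>F. bellman_op M h (Qf M f (h + 1)) \<in> Gh h)"

definition residual :: "('s, 'a) mdp \<Rightarrow> nat \<Rightarrow> ('s, 'a) hyp \<Rightarrow> 's \<times> 'a \<Rightarrow> real" where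
  "residual M h f x = Qf M f h x - bellman_op M h (Qf M f (h + 1)) x"


section \<open>Bellman eluder dimension for Dirac distributions\<close>

definition eluder_seq ::
  "('s, 'a) mdp \<Rightarrow> ('s, 'a) hyp set \<Rightarrow> nat \<Rightarrow> real \<Rightarrow> ('s \<times> 'a) list \<Rightarrow> bool" where
  "eluder_seq M F h \<epsilon> xs \<longleftrightarrow>
     (\<exists>\<epsilon>'\<ge>\<epsilon>. \<forall>j<length xs. \<exists>f\<in>F.
        sqrt (\<Sum>i<j. (residual M h f (xs ! i))\<^sup>2) \<le> \<epsilon>' \<and> \<bar>residual M h f (xs ! j)\<bar> > \<epsilon>')"

text \<open>The value is \<open>\<infinity>\<close> if the lengths are unbounded.\<close>

definition bellman_eluder_dim ::
  "('s, 'a) mdp \<Rightarrow> ('s, 'a) hyp set \<Rightarrow> real \<Rightarrow> enat" where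
  "bellman_eluder_dim M F \<epsilon> =
     (SUP h\<in>{1..horizon M}. SUP xs\<in>{xs. eluder_seq M F h \<epsilon> xs}. enat (length xs))"


section \<open>EC classes of \<open>\<ell>\<^sub>2\<close> type\<close>

text \<open>A loss maps \<open>h, f', \<zeta>\<^sub>h, \<eta>\<^sub>h, f, g\<close> to a vector, with \<open>\<zeta>\<^sub>h = s\<^sub>h\<^sub>+\<^sub>1\<close> and
  \<open>\<eta>\<^sub>h = (s\<^sub>h, a\<^sub>h)\<close>.\<close>

type_synonym ('s, 'a, 'v) loss =
  "nat \<Rightarrow> ('s, 'a) hyp \<Rightarrow> 's \<Rightarrow> 's \<times> 'a \<Rightarrow> ('s, 'a) hyp \<Rightarrow> ('s, 'a) hyp \<Rightarrow> 'v"

definition mean_loss ::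
  "('s, 'a) mdp \<Rightarrow> ('s, 'a, 'v::euclidean_space) loss \<Rightarrow>
   nat \<Rightarrow> ('s, 'a) hyp \<Rightarrow> 's \<times> 'a \<Rightarrow> ('s, 'a) hyp \<Rightarrow> ('s, 'a) hyp \<Rightarrow> 'v" where
  "mean_loss M l h f' x f g = (\<integral>s'. l h f' s' x f g \<partial>trans M h x)"

text \<open>\<open>C\<close> is the constant hidden in the \<open>O\<close>-notation.\<close>

definition ec_generalization ::
  "real \<Rightarrow> nat \<Rightarrow> real \<Rightarrow> ('s, 'a) mdp \<Rightarrow> ('s, 'a) hyp set \<Rightarrow>
   ('s, 'a, 'v::euclidean_space) loss \<Rightarrow> real \<Rightarrow> bool" where
  "ec_generalization C K R M F l d \<longleftrightarrow>
     (\<forall>\<beta>\<ge>R\<^sup>2. \<forall>h\<in>{1..horizon M}. \<forall>f x.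
        (\<forall>i\<in>{1..K}. f i \<in> F) \<longrightarrow>
        (\<forall>k\<in>{1..K}. (\<Sum>i\<in>{1..<k}. (norm (mean_loss M l h (f i) (x i) (f k) (f k)))\<^sup>2) \<le> \<beta>) \<longrightarrow>
        (\<forall>k\<in>{1..K}. (\<Sum>i=1..k. (norm (mean_loss M l h (f i) (x i) (f i) (f i)))\<^sup>2)
           \<le> C * (d * \<beta> * ln (real K))))"

text \<open>The hypotheses \<open>f\<^sup>1, \<dots>, f\<^sup>K\<close> may be random, as they are when an algorithm selects them
  from data: \<open>\<Omega>\<close> is the underlying probability space, and an event of probability at least
  \<open>1 - \<delta>\<close> is a measurable set on which the inequality holds. \<open>pol f\<close> is the greedy policy
  of \<open>f\<close>.\<close>

definition kappa_dominance ::
  "'w measure \<Rightarrow> nat \<Rightarrow> ('s, 'a) mdp \<Rightarrow> ('s, 'a) hyp set \<Rightarrow>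
   (('s, 'a) hyp \<Rightarrow> ('s, 'a) policy) \<Rightarrow> ('s, 'a, 'v::euclidean_space) loss \<Rightarrow> real \<Rightarrow> bool" where
  "kappa_dominance \<Omega> K M F pol l \<kappa> \<longleftrightarrow>
     (\<forall>f. (\<forall>i\<in>{1..K}. \<forall>\<omega>\<in>space \<Omega>. f i \<omega> \<in> F) \<longrightarrow>
       (\<forall>\<delta>\<in>{0<..<1}. \<forall>k\<in>{1..K}. \<exists>E\<in>sets \<Omega>. measure \<Omega> E \<ge> 1 - \<delta> \<and>
         (\<forall>\<omega>\<in>E.
            (\<Sum>i=1..k. Vf M (f i \<omega>) 1 (init M) - value_pi M (pol (f i \<omega>)) 1 (init M))
            \<le> \<kappa> * (\<Sum>h=1..horizon M. \<Sum>i=1..k.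
                 expect_pi M (pol (f i \<omega>)) h
                   (\<lambda>x. norm (mean_loss M l h (f i \<omega>) x (f i \<omega>) (f i \<omega>)))))))"

definition l2_EC_class ::
  "real \<Rightarrow> 'w measure \<Rightarrow> nat \<Rightarrow> real \<Rightarrow> (('s, 'a) hyp \<Rightarrow> ('s, 'a) policy) \<Rightarrow>
   ('s, 'a) mdp \<Rightarrow> ('s, 'a) hyp set \<Rightarrow> ('s, 'a) hyp set \<Rightarrow>
   ('s, 'a, 'v::euclidean_space) loss \<Rightarrow> real \<Rightarrow> real \<Rightarrow> bool" where
  "l2_EC_class C \<Omega> K R pol M F G l d \<kappa> \<longleftrightarrow>
     F \<subseteq> G \<and> realizable M F \<and>
     (\<forall>h\<in>{1..horizon M}. \<forall>f'\<in>F. \<forall>f\<in>F. \<forall>g\<in>G. \<forall>x.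
        (\<lambda>s'. l h f' s' x f g) \<in> borel_measurable (states M) \<and>
        (\<forall>s'. norm (l h f' s' x f g) \<le> R)) \<and>
     ec_generalization C K R M F l d \<and>
     kappa_dominance \<Omega> K M F pol l \<kappa>"

definition bellman_loss :: "('s, 'a) mdp \<Rightarrow> ('s, 'a, real) loss" where
  "bellman_loss M h f' s' x f g = Qf M g h x - reward M h x - Vf M f (h + 1) s'"

end

theory Submission
  imports Defs
begin

text \<open>
  Generalization: the indices with residual above \<open>\<epsilon>'\<close> are distributed greedily over about
  \<open>\<beta> / \<epsilon>'\<^sup>2\<close> buckets so that each bucket, read in order, is an eluder sequence for \<open>\<epsilon>'\<close>;
  the budget \<open>\<beta>\<close> guarantees that some bucket always has room. Hence at most
  \<open>d (\<beta> / \<epsilon>'\<^sup>2 + 1)\<close> residuals exceed \<open>\<epsilon>'\<close>, so the \<open>t\<close>-th largest square is at most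
  \<open>1 / K + \<beta> d / (t - d)\<close> for \<open>t > d\<close>, and summation gives the logarithm.
  Dominance: since \<open>V\<^sub>h\<^sub>,\<^sub>f(s) = f\<^sub>h(s, \<pi>\<^sub>f(s))\<close>, the Bellman residuals telescope along the trajectory
  of \<open>\<pi>\<^sub>f\<close> to the difference of the predicted and the actual value, with no error probability.
\<close>

section \<open>Combinatorics of large residuals\<close>

text \<open>The elements of \<open>S\<close> arrive in increasing order. The load of a new element
  \<open>b\<close> over all buckets is at most \<beta> \<le> m u, so by averaging some bucket has
  load at most u, and \<open>b\<close> is appended there. Quantifying over all \<open>g\<close> says
  that the lists together enumerate \<open>S\<close> without repetition: \<open>g = r b\<close>
  gives the averaging, and \<open>g = 1\<close> will count \<open>S\<close>.\<close>

lemma bucket_lists: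
  fixes r :: "nat \<Rightarrow> nat \<Rightarrow> real" and m :: nat
  assumes "finite S" and r: "\<And>k i. 0 \<le> r k i" and m: "0 < m" and u: "\<beta> \<le> real m * u"
    and "\<And>k. k \<in> S \<Longrightarrow> (\<Sum>i\<in>{i\<in>S. i < k}. r k i) \<le> \<beta>"
  shows "\<exists>L. (\<forall>g::nat \<Rightarrow> real. (\<Sum>j<m. sum_list (map g (L j))) = sum g S) \<and>
             (\<forall>j<m. set (L j) \<subseteq> S) \<and>
             (\<forall>j<m. \<forall>p<length (L j). (\<Sum>q<p. r (L j ! p) (L j ! q)) \<le> u)"
  using assms(1,5)
proof (induction S rule: finite_linorder_max_induct)
  case empty
  show ?case by (rule exI[of _ "\<lambda>_. []"]) simp
next
  case (insert b S)
  have prev: "(\<Sum>i\<in>{i\<in>S. i < k}. r k i) \<le> \<beta>" if "k \<in> S" for k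
  proof -
    have "{i\<in>insert b S. i < k} = {i\<in>S. i < k}"
      using insert.hyps(2) that by force
    with insert.prems[of k] that show ?thesis by simp
  qed
  obtain L where L: "\<And>g::nat \<Rightarrow> real. (\<Sum>j<m. sum_list (map g (L j))) = sum g S"
      "\<And>j. j < m \<Longrightarrow> set (L j) \<subseteq> S"
      "\<And>j p. j < m \<Longrightarrow> p < length (L j) \<Longrightarrow> (\<Sum>q<p. r (L j ! p) (L j ! q)) \<le> u"
    using insert.IH[OF prev] by blast
  have "{i\<in>insert b S. i < b} = S" using insert.hyps(2) by auto
  with insert.prems[of b] have total: "(\<Sum>j<m. sum_list (map (r b) (L j))) \<le> \<beta>"
    by (simp add: L(1))
  have "\<exists>j<m. sum_list (map (r b) (L j)) \<le> u"
  proof (rule ccontr)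
    assume "\<not> ?thesis"
    then have "(\<Sum>j<m. u) < (\<Sum>j<m. sum_list (map (r b) (L j)))"
      using m by (intro sum_strict_mono) (auto simp: not_le)
    with total u show False by simp
  qed
  then obtain j0 where j0: "j0 < m" "sum_list (map (r b) (L j0)) \<le> u" by blast
  let ?L = "L(j0 := L j0 @ [b])"
  have "(\<Sum>j<m. sum_list (map g (?L j))) = sum g (insert b S)" for g :: "nat \<Rightarrow> real"
  proof -
    have "(\<Sum>j<m. sum_list (map g (?L j)))
        = (\<Sum>j<m. sum_list (map g (L j)) + (if j = j0 then g b else 0))"
      by (rule sum.cong) auto
    also have "\<dots> = sum g S + g b"
      using j0(1) by (simp add: sum.distrib L(1))
    finally show ?thesis
      using insert.hyps by (subst sum.insert) auto
  qed
  moreover have "\<forall>j<m. set (?L j) \<subseteq> insert b S"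
    using L(2) by auto
  \<comment> \<open>The load at a position involves only that entry and earlier ones, so appending
    \<open>b\<close> creates one new condition and leaves the old ones unchanged.\<close>
  moreover have "(\<Sum>q<p. r (?L j ! p) (?L j ! q)) \<le> u" if "j < m" "p < length (?L j)" for j p
  proof (cases "j = j0 \<and> p = length (L j0)")
    case True
    then show ?thesis
      using j0(2) by (simp add: nth_append sum_list_sum_nth atLeast0LessThan)
  next
    case False
    then have p: "p < length (L j)" using that by (auto split: if_splits)
    have "?L j ! q = L j ! q" if "q \<le> p" for q
      using p that by (auto simp: nth_append)
    then show ?thesis using L(3)[OF that(1) p] by simp
  qed
  ultimately show ?case by blast
qed

text \<open>This replaces sorting: from a set of n elements an element of value at most
  \<open>b n\<close> is removed, and the process is repeated. Thus \<open>b n\<close> acts as a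
  bound on the n-th largest value.\<close>

lemma sum_le_of_min_le:
  fixes a :: "'i \<Rightarrow> real" and b :: "nat \<Rightarrow> real"
  assumes "finite A" and "\<And>B. B \<subseteq> A \<Longrightarrow> B \<noteq> {} \<Longrightarrow> \<exists>i\<in>B. a i \<le> b (card B)"
  shows "sum a A \<le> sum b {1..card A}"
  using assms
proof (induction A rule: finite_psubset_induct)
  case (psubset A)
  show ?case
  proof (cases "A = {}")
    case False
    with psubset.prems[of A] obtain i where i: "i \<in> A" "a i \<le> b (card A)" by auto
    have "sum a (A - {i}) \<le> sum b {1..card (A - {i})}"
      using psubset.prems i by (intro psubset.IH) auto
    moreover have "sum a A = a i + sum a (A - {i})"
      using i psubset.hyps by (intro sum.remove) auto
    moreover have "card A = Suc (card (A - {i}))"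
      using i psubset.hyps by (intro card.remove) auto
    ultimately show ?thesis using i(2) by simp
  qed simp
qed

text \<open>Each bucket, with load bound \<open>\<epsilon>'\<^sup>2\<close>, is an eluder sequence
  at scale \<open>\<epsilon>'\<close>: the hypothesis attached to an entry has small residuals on
  the entries before it and a large one at its own pair. So every bucket has length at most d, and
  only the buckets need counting.\<close>

lemma card_exceeding_le:
  fixes M :: "('s, 'a) mdp" and f :: "nat \<Rightarrow> ('s, 'a) hyp"
  assumes dim: "bellman_eluder_dim M F \<epsilon> \<le> enat d" and h: "h \<in> {1..horizon M}"
    and \<epsilon>: "0 < \<epsilon>" "\<epsilon> \<le> \<epsilon>'" and "finite S" and \<beta>: "0 \<le> \<beta>"
    and fF: "\<And>i. i \<in> S \<Longrightarrow> f i \<in> F"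
    and small: "\<And>k. k \<in> S \<Longrightarrow> (\<Sum>i\<in>{i\<in>S. i < k}. (residual M h (f k) (x i))\<^sup>2) \<le> \<beta>"
    and large: "\<And>k. k \<in> S \<Longrightarrow> \<epsilon>' < \<bar>residual M h (f k) (x k)\<bar>"
  shows "real (card S) \<le> real d * (\<beta> / \<epsilon>'\<^sup>2 + 1)"
proof -
  \<comment> \<open>Rounding down and adding one gives both estimates: enough buckets for \<beta>
    \<le> m \<open>\<epsilon>'\<^sup>2\<close>, and no more than
    \<open>\<beta> / \<epsilon>'\<^sup>2 + 1\<close> of them.\<close>
  define m where "m = nat \<lfloor>\<beta> / \<epsilon>'\<^sup>2\<rfloor> + 1"
  have m_le: "real m \<le> \<beta> / \<epsilon>'\<^sup>2 + 1"
    using \<beta> by (simp add: m_def)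
  have "\<beta> / \<epsilon>'\<^sup>2 \<le> real m"
    unfolding m_def using \<beta> by linarith
  moreover have m0: "0 < m" by (simp add: m_def)
  ultimately have u: "\<beta> \<le> real m * \<epsilon>'\<^sup>2" using \<epsilon> by (simp add: field_simps)
  obtain L where L: "\<And>g::nat \<Rightarrow> real. (\<Sum>j<m. sum_list (map g (L j))) = sum g S"
      "\<And>j. j < m \<Longrightarrow> set (L j) \<subseteq> S"
      "\<And>j p. j < m \<Longrightarrow> p < length (L j) \<Longrightarrow>
         (\<Sum>q<p. (residual M h (f (L j ! p)) (x (L j ! q)))\<^sup>2) \<le> \<epsilon>'\<^sup>2"
    using bucket_lists[of S "\<lambda>k i. (residual M h (f k) (x i))\<^sup>2" m \<beta> "\<epsilon>'\<^sup>2",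
        OF \<open>finite S\<close> zero_le_power2 m0 u small] by blast
  have len: "length (L j) \<le> d" if j: "j < m" for j
  proof -
    have "eluder_seq M F h \<epsilon> (map x (L j))"
      unfolding eluder_seq_def
    proof (intro exI[of _ \<epsilon>'] conjI allI impI \<epsilon>)
      fix p assume p: "p < length (map x (L j))"
      then have S: "L j ! p \<in> S" using L(2)[OF j] by auto
      have "sqrt (\<Sum>i<p. (residual M h (f (L j ! p)) (map x (L j) ! i))\<^sup>2) \<le> \<epsilon>'"
        using L(3)[OF j, of p] p \<epsilon> by (intro real_le_lsqrt) (auto intro: sum_nonneg)
      then show "\<exists>g\<in>F. sqrt (\<Sum>i<p. (residual M h g (map x (L j) ! i))\<^sup>2) \<le> \<epsilon>' \<and>
                     \<epsilon>' < \<bar>residual M h g (map x (L j) ! p)\<bar>"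
        using S fF large p by auto
    qed
    then have "enat (length (map x (L j))) \<le> bellman_eluder_dim M F \<epsilon>"
      unfolding bellman_eluder_dim_def using h by (intro SUP_upper2[OF h] SUP_upper) auto
    with dim have "enat (length (L j)) \<le> enat d" by (metis length_map order_trans)
    then show ?thesis by simp
  qed
  have "real (card S) = (\<Sum>j<m. real (length (L j)))"
    using L(1)[of "\<lambda>_. 1"] by (simp add: sum_list_triv)
  also have "\<dots> \<le> (\<Sum>j<m. real d)"
    using len by (intro sum_mono) auto
  also have "\<dots> \<le> real d * (\<beta> / \<epsilon>'\<^sup>2 + 1)"
    using m_le by (simp add: mult.commute mult_left_mono)
  finally show ?thesis .
qed

text \<open>If n > d squared residuals all exceed u \<ge> 1/K, the counting bound gives n \<le> d
  (\<beta>/u + 1), that is, u \<le> \<beta> d / (n - d). This controls the n-th largest square for n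
  > d; the d largest are bounded by \<open>B\<^sup>2\<close>. The tail sums to a harmonic
  number.\<close>

lemma sum_residual_square_le:
  fixes M :: "('s, 'a) mdp" and f :: "nat \<Rightarrow> ('s, 'a) hyp"
  assumes dim: "bellman_eluder_dim M F (1 / sqrt (real K)) \<le> enat d" and h: "h \<in> {1..horizon M}"
    and K: "2 \<le> K" and d: "0 < d" and \<beta>: "B\<^sup>2 \<le> \<beta>" "1 \<le> \<beta>" and k: "k \<le> K"
    and fF: "\<And>i. i \<in> {1..k} \<Longrightarrow> f i \<in> F"
    and bnd: "\<And>i. i \<in> {1..k} \<Longrightarrow> \<bar>residual M h (f i) (x i)\<bar> \<le> B"
    and small: "\<And>k'. k' \<in> {1..k} \<Longrightarrow> (\<Sum>i\<in>{1..<k'}. (residual M h (f k') (x i))\<^sup>2) \<le> \<beta>"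
  shows "(\<Sum>i=1..k. (residual M h (f i) (x i))\<^sup>2) \<le> 10 * (real d * \<beta> * ln (real K))"
proof -
  \<comment> \<open>The summand 1/K keeps the threshold \<open>sqrt (b t)\<close> at or above the
    scale \<open>1 / sqrt K\<close> of the dimension, and makes the later contradiction strict. It
    costs at most 1 in total. The natural subtraction \<open>t - d\<close> is only used for t >
    d.\<close>
  define b where "b t = (if t \<le> d then B\<^sup>2 else 1 / real K + \<beta> * real d / real (t - d))" for t
  have K0: "0 < real K" using K by simp
  have "(\<Sum>i=1..k. (residual M h (f i) (x i))\<^sup>2) \<le> sum b {1..card {1..k}}"
  proof (rule sum_le_of_min_le)
    fix A assume A: "A \<subseteq> {1..k}" "A \<noteq> {}"
    have fin: "finite A" using A by (rule_tac finite_subset) auto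
    show "\<exists>i\<in>A. (residual M h (f i) (x i))\<^sup>2 \<le> b (card A)"
    proof (cases "card A \<le> d")
      case True
      obtain i where "i \<in> A" using A by auto
      then have "(residual M h (f i) (x i))\<^sup>2 \<le> B\<^sup>2"
        using bnd A power_mono[of "\<bar>residual M h (f i) (x i)\<bar>" B 2] by auto
      with \<open>i \<in> A\<close> True show ?thesis by (auto simp: b_def)
    next
      case False
      show ?thesis
      proof (rule ccontr)
        assume "\<not> ?thesis"
        then have gt: "b (card A) < (residual M h (f i) (x i))\<^sup>2" if "i \<in> A" for i
          using that by (auto simp: not_le)
        let ?u = "b (card A)"
        have u: "?u = 1 / real K + \<beta> * real d / (real (card A) - real d)"
          using False by (simp add: b_def)
        have pos: "0 < real (card A) - real d" using False by simp
        have uK: "1 / real K \<le> ?u" using pos \<beta> by (simp add: u)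
        then have u0: "0 < ?u" using K0 by (meson divide_pos_pos less_le_trans zero_less_one)
        have "real (card A) \<le> real d * (\<beta> / (sqrt ?u)\<^sup>2 + 1)"
        proof (rule card_exceeding_le[OF dim h])
          show "1 / sqrt (real K) \<le> sqrt ?u"
            using real_sqrt_le_mono[OF uK] by (simp add: real_sqrt_divide)
          show "(\<Sum>i\<in>{i\<in>A. i < k'}. (residual M h (f k') (x i))\<^sup>2) \<le> \<beta>" if "k' \<in> A" for k'
          proof -
            have "(\<Sum>i\<in>{i\<in>A. i < k'}. (residual M h (f k') (x i))\<^sup>2)
                \<le> (\<Sum>i\<in>{1..<k'}. (residual M h (f k') (x i))\<^sup>2)"
              using A by (intro sum_mono2) auto
            also have "\<dots> \<le> \<beta>"
              using A that by (intro small) blast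
            finally show ?thesis .
          qed
          show "sqrt ?u < \<bar>residual M h (f i) (x i)\<bar>" if "i \<in> A" for i
            using real_sqrt_less_mono[OF gt[OF that]] by simp
          show "0 < 1 / sqrt (real K)" using K0 by simp
          show "finite A" by (rule fin)
          show "0 \<le> \<beta>" using \<beta> by simp
          show "f i \<in> F" if "i \<in> A" for i using A that by (intro fF) blast
        qed
        \<comment> \<open>With n = \<open>card A\<close>, counting gives (n - d) u \<le> \<beta> d,
          whereas by the choice of \<open>b\<close> the left side equals (n - d)/K + \<beta>
          d.\<close>
        then have "(real (card A) - real d) * ?u \<le> \<beta> * real d"
          using u0 by (simp add: field_simps)
        moreover have "\<beta> * real d < (real (card A) - real d) * ?u"
          using pos K0 by (simp add: u distrib_left)
        ultimately show False by simp
      qed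
    qed
  qed simp
  \<comment> \<open>Since \<open>b\<close> is nonnegative, the range can be enlarged to d + k terms;
    it then splits into d crude terms and k harmonic ones, whether or not k exceeds d.\<close>
  also have "\<dots> \<le> (\<Sum>t\<in>{1..d + k}. b t)"
    using \<beta> by (intro sum_mono2) (auto simp: b_def)
  also have "(\<Sum>t\<in>{1..d + k}. b t) = B\<^sup>2 * real d + (real k / real K + \<beta> * real d * harm k)"
  proof -
    have "{1..d + k} = {1..d} \<union> {1 + d..k + d}" by auto
    then have "(\<Sum>t\<in>{1..d + k}. b t) = sum b {1..d} + sum b {1 + d..k + d}"
      by (simp add: sum.union_disjoint)
    moreover have "sum b {1..d} = B\<^sup>2 * real d"
      by (simp add: b_def)
    moreover have "sum b {1 + d..k + d} = (\<Sum>t=1..k. b (t + d))"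
      by (rule sum.shift_bounds_cl_nat_ivl)
    moreover have "(\<Sum>t=1..k. b (t + d)) = (\<Sum>t=1..k. 1 / real K + \<beta> * real d * inverse (real t))"
      by (rule sum.cong) (auto simp: b_def divide_inverse)
    moreover have "\<dots> = real k / real K + \<beta> * real d * harm k"
      unfolding sum.distrib harm_def sum_distrib_left by simp
    ultimately show ?thesis by simp
  qed
  finally have "(\<Sum>i=1..k. (residual M h (f i) (x i))\<^sup>2)
      \<le> B\<^sup>2 * real d + (real k / real K + \<beta> * real d * harm k)" .
  \<comment> \<open>The sequence \<open>harm n - ln n\<close> decreases from its value 1 at n = 1; k
    = 0 is separate because the comparison starts at 1.\<close>
  moreover have "harm k \<le> 1 + ln (real K)"
  proof (cases "k = 0")
    case False
    then have "harm k \<le> 1 + ln (real k)"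
      using euler_mascheroni_sequence_decreasing[of 1 k] by (simp add: harm_def)
    also have "\<dots> \<le> 1 + ln (real K)"
      using False k by simp
    finally show ?thesis .
  qed (use K in \<open>simp add: harm_def\<close>)
  then have "\<beta> * real d * harm k \<le> \<beta> * real d * (1 + ln (real K))"
    using \<beta> by (intro mult_left_mono) auto
  moreover have "real k / real K \<le> 1" using k K0 by simp
  ultimately have main: "(\<Sum>i=1..k. (residual M h (f i) (x i))\<^sup>2)
      \<le> B\<^sup>2 * real d + (1 + \<beta> * real d * (1 + ln (real K)))"
    by linarith
  \<comment> \<open>The bound so far is at most 3 \<beta> d + \<beta> d ln K. As ln K \<ge> ln 2
    \<ge> 2/3, the first term is at most 4.5 \<beta> d ln K, well within the constant 10.\<close>
  have bd: "1 \<le> \<beta> * real d" using \<beta> d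
    by (metis One_nat_def Suc_leI mult_mono' mult_1 of_nat_1 of_nat_mono zero_le_one)
  have "B\<^sup>2 * real d \<le> \<beta> * real d" using \<beta> by (simp add: mult_right_mono)
  moreover have "2 / 3 \<le> ln (real K)"
  proof -
    have "2 / 3 \<le> ln (2::real)" using ln2_ge_two_thirds by simp
    also have "\<dots> \<le> ln (real K)" using K by simp
    finally show ?thesis .
  qed
  then have "\<beta> * real d * (2 / 3) \<le> \<beta> * real d * ln (real K)"
    using bd by (intro mult_left_mono) auto
  ultimately show ?thesis using main bd by (simp add: algebra_simps)
qed

section \<open>Trajectory laws and the Markov property\<close>

text \<open>A bind is the join of the image of \<open>M\<close> under the kernel; boundedness of
  \<open>f\<close> and the mass bound 1 for subprobabilities allow the integral to be
  iterated.\<close>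

lemma integral_bind_bounded:
  fixes f :: "'b \<Rightarrow> real"
  assumes "prob_space M" and N: "N \<in> M \<rightarrow>\<^sub>M subprob_algebra B"
    and f: "f \<in> borel_measurable B" "\<And>x. x \<in> space B \<Longrightarrow> \<bar>f x\<bar> \<le> c"
  shows "(\<integral>x. f x \<partial>(M \<bind> N)) = (\<integral>x. \<integral>y. f y \<partial>N x \<partial>M)"
proof -
  interpret prob_space M by fact
  have "(\<integral>x. f x \<partial>(M \<bind> N)) = (\<integral>M'. \<integral>x. f x \<partial>M' \<partial>distr M (subprob_algebra B) N)"
    unfolding bind_nonempty''[OF N not_empty]
  proof (rule integral_join[OF f, where B' = 1])
    show "finite_measure (distr M (subprob_algebra B) N)"
      by (intro finite_measure_distr N)
    show "AE M' in distr M (subprob_algebra B) N. emeasure M' (space M') \<le> ennreal 1"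
      by (rule AE_I2) (auto simp: space_subprob_algebra subprob_space.emeasure_space_le_1)
  qed simp_all
  also have "\<dots> = (\<integral>x. \<integral>y. f y \<partial>N x \<partial>M)"
    using f(1) by (intro integral_distr N integral_measurable_subprob_algebra)
  finally show ?thesis .
qed

text \<open>This is the kernel that prolongs a path by one state. It is measurable because the
  transition law depends only on the last coordinate, present since h \<le> t, and path extension is
  jointly measurable.\<close>

lemma traj_step_measurable:
  assumes P[measurable]: "trans M t \<in> states M \<Otimes>\<^sub>M actions M \<rightarrow>\<^sub>M prob_algebra (states M)"
    and \<pi>[measurable]: "\<pi> t \<in> states M \<rightarrow>\<^sub>M actions M" and "h \<le> t"
  shows "(\<lambda>\<omega>. distr (trans M t (\<omega> t, \<pi> t (\<omega> t))) (PiM {h..Suc t} (\<lambda>_. states M))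
            (\<lambda>s'. fun_upd \<omega> (Suc t) s'))
         \<in> PiM {h..t} (\<lambda>_. states M) \<rightarrow>\<^sub>M prob_algebra (PiM {h..Suc t} (\<lambda>_. states M))"
proof (rule measurable_distr_prob_space2)
  have [measurable]: "(\<lambda>\<omega>. \<omega> t) \<in> PiM {h..t} (\<lambda>_. states M) \<rightarrow>\<^sub>M states M"
    using \<open>h \<le> t\<close> by (intro measurable_component_singleton) auto
  show "(\<lambda>\<omega>. trans M t (\<omega> t, \<pi> t (\<omega> t))) \<in> PiM {h..t} (\<lambda>_. states M) \<rightarrow>\<^sub>M prob_algebra (states M)"
    by measurable
  have "{h..Suc t} = {h..t} \<union> {Suc t}" using \<open>h \<le> t\<close> by auto
  then show "(\<lambda>(\<omega>, s'). fun_upd \<omega> (Suc t) s') \<in> PiM {h..t} (\<lambda>_. states M) \<Otimes>\<^sub>M states M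
      \<rightarrow>\<^sub>M PiM {h..Suc t} (\<lambda>_. states M)"
    unfolding split_beta' by (rule measurable_fun_upd) measurable
qed

context
  fixes M :: "('s, 'a) mdp" and \<pi> :: "('s, 'a) policy" and h :: nat
  assumes mdp: "episodic_mdp M" and pol: "\<pi> \<in> policies M" and h: "1 \<le> h"
begin

lemma space_states [simp]: "space (states M) = UNIV"
  using mdp by (simp add: episodic_mdp_def)

lemma space_pair [simp]: "space (states M \<Otimes>\<^sub>M actions M) = UNIV"
  using mdp by (simp add: episodic_mdp_def space_pair_measure)

lemma trans_measurable:
  "t \<in> {1..horizon M} \<Longrightarrow> trans M t \<in> states M \<Otimes>\<^sub>M actions M \<rightarrow>\<^sub>M prob_algebra (states M)"
  using mdp by (auto simp: episodic_mdp_def)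

lemma policy_measurable: "t \<in> {1..horizon M} \<Longrightarrow> \<pi> t \<in> states M \<rightarrow>\<^sub>M actions M"
  using pol by (auto simp: policies_def)

lemma trans_prob_algebra:
  assumes "t \<in> {1..horizon M}"
  shows "trans M t x \<in> space (prob_algebra (states M))"
  using measurable_space[OF trans_measurable[OF assms], of x] by simp

lemma prob_space_trans: "t \<in> {1..horizon M} \<Longrightarrow> prob_space (trans M t x)"
  and sets_trans: "t \<in> {1..horizon M} \<Longrightarrow> sets (trans M t x) = sets (states M)"
  using trans_prob_algebra by (auto simp: space_prob_algebra)

lemma traj_from_prob_algebra:
  "h + n \<le> horizon M \<Longrightarrow>
     traj_from M \<pi> h s n \<in> space (prob_algebra (PiM {h..h + n} (\<lambda>_. states M)))"
proof (induction n)
  case 0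
  then show ?case
    by (auto simp: space_prob_algebra space_PiM intro!: prob_space_return)
next
  case (Suc n)
  then have n: "h + n \<in> {1..horizon M}" using h by auto
  have IH: "traj_from M \<pi> h s n \<in> space (prob_algebra (PiM {h..h + n} (\<lambda>_. states M)))"
    using Suc by simp
  note step = traj_step_measurable[of M "h + n" \<pi> h, OF trans_measurable[OF n] policy_measurable[OF n], simplified]
  show ?case
    using prob_space_bind'[OF IH step] sets_bind'[OF IH step] by (simp add: space_prob_algebra)
qed

lemma prob_space_traj_from: "h + n \<le> horizon M \<Longrightarrow> prob_space (traj_from M \<pi> h s n)"
  and sets_traj_from: "h + n \<le> horizon M \<Longrightarrow>
        sets (traj_from M \<pi> h s n) = sets (PiM {h..h + n} (\<lambda>_. states M))"
  using traj_from_prob_algebra by (auto simp: space_prob_algebra)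

lemma state_measurable:
  assumes "h + n \<le> horizon M" "t \<in> {h..h + n}"
  shows "(\<lambda>\<omega>. \<omega> t) \<in> traj_from M \<pi> h s n \<rightarrow>\<^sub>M states M"
  using assms by (subst measurable_cong_sets[OF sets_traj_from refl]) auto

text \<open>Integration over the last state comes first, conditionally on the path before it. The
  facts below about single coordinates are instances of this.\<close>

lemma integral_traj_from_Suc:
  fixes g :: "(nat \<Rightarrow> 's) \<Rightarrow> real"
  assumes n: "h + Suc n \<le> horizon M"
    and g: "g \<in> borel_measurable (PiM {h..Suc (h + n)} (\<lambda>_. states M))" "\<And>\<omega>. \<bar>g \<omega>\<bar> \<le> c"
  shows "(\<integral>\<omega>. g \<omega> \<partial>traj_from M \<pi> h s (Suc n)) =
         (\<integral>\<omega>. \<integral>s'. g (fun_upd \<omega> (Suc (h + n)) s') \<partial>trans M (h + n) (\<omega> (h + n), \<pi> (h + n) (\<omega> (h + n)))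
            \<partial>traj_from M \<pi> h s n)"
proof -
  have t: "h + n \<in> {1..horizon M}" using n h by auto
  let ?S = "\<lambda>_::nat. states M"
  let ?N = "\<lambda>\<omega>. distr (trans M (h + n) (\<omega> (h + n), \<pi> (h + n) (\<omega> (h + n))))
         (PiM {h..Suc (h + n)} ?S) (\<lambda>s'. fun_upd \<omega> (Suc (h + n)) s')"
  have sets: "sets (traj_from M \<pi> h s n) = sets (PiM {h..h + n} ?S)"
    using n by (intro sets_traj_from) simp
  have N: "?N \<in> traj_from M \<pi> h s n \<rightarrow>\<^sub>M subprob_algebra (PiM {h..Suc (h + n)} ?S)"
    using traj_step_measurable[of M "h + n" \<pi> h, OF trans_measurable[OF t] policy_measurable[OF t]]
    by (subst measurable_cong_sets[OF sets refl]) (auto intro: measurable_prob_algebraD)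
  have "(\<integral>\<omega>. g \<omega> \<partial>traj_from M \<pi> h s (Suc n)) = (\<integral>\<omega>. \<integral>\<omega>'. g \<omega>' \<partial>?N \<omega> \<partial>traj_from M \<pi> h s n)"
    using integral_bind_bounded[OF _ N g] prob_space_traj_from[of n s] n by simp
  also have "\<dots> = (\<integral>\<omega>. \<integral>s'. g (fun_upd \<omega> (Suc (h + n)) s')
      \<partial>trans M (h + n) (\<omega> (h + n), \<pi> (h + n) (\<omega> (h + n))) \<partial>traj_from M \<pi> h s n)"
  proof (intro Bochner_Integration.integral_cong refl integral_distr g(1))
    fix \<omega> assume "\<omega> \<in> space (traj_from M \<pi> h s n)"
    then have \<omega>: "\<omega> \<in> space (PiM {h..h + n} ?S)" by (simp add: sets_eq_imp_space_eq[OF sets])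
    have I: "{h..Suc (h + n)} = {h..h + n} \<union> {Suc (h + n)}" by auto
    show "(\<lambda>s'. fun_upd \<omega> (Suc (h + n)) s')
        \<in> trans M (h + n) (\<omega> (h + n), \<pi> (h + n) (\<omega> (h + n))) \<rightarrow>\<^sub>M PiM {h..Suc (h + n)} ?S"
      using \<omega> by (subst measurable_cong_sets[OF sets_trans[OF t] refl])
        (auto intro!: measurable_fun_upd[OF I] measurable_const)
  qed
  finally show ?thesis .
qed

context
  fixes \<phi> :: "'s \<Rightarrow> real" and c :: real
  assumes \<phi>: "\<phi> \<in> borel_measurable (states M)" "\<And>s. \<bar>\<phi> s\<bar> \<le> c"
begin

lemma integral_last_state:
  assumes n: "h + Suc n \<le> horizon M"
  shows "(\<integral>\<omega>. \<phi> (\<omega> (Suc (h + n))) \<partial>traj_from M \<pi> h s (Suc n)) =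
         (\<integral>\<omega>. \<integral>s'. \<phi> s' \<partial>trans M (h + n) (\<omega> (h + n), \<pi> (h + n) (\<omega> (h + n))) \<partial>traj_from M \<pi> h s n)"
  using \<phi> by (subst integral_traj_from_Suc[OF n, where c = c]) (auto intro!: measurable_compose[OF _ \<phi>(1)])

text \<open>Consistency of the path laws: prolonging a path leaves its earlier coordinates alone, so
  the added inner integral is that of a constant against a probability measure.\<close>

lemma integral_earlier_state:
  assumes "n \<le> m" "h + m \<le> horizon M" "t \<in> {h..h + n}"
  shows "(\<integral>\<omega>. \<phi> (\<omega> t) \<partial>traj_from M \<pi> h s m) = (\<integral>\<omega>. \<phi> (\<omega> t) \<partial>traj_from M \<pi> h s n)"
  using assms(1,2)
proof (induction m rule: dec_induct)
  case (step m)
  have m: "h + m \<in> {1..horizon M}" using step.prems h by auto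
  have "(\<integral>\<omega>. \<phi> (\<omega> t) \<partial>traj_from M \<pi> h s (Suc m)) = (\<integral>\<omega>. \<phi> (\<omega> t) \<partial>traj_from M \<pi> h s m)"
    using assms(3) step.hyps \<phi> prob_space.prob_space[OF prob_space_trans[OF m]]
    by (subst integral_traj_from_Suc[OF step.prems, where c = c])
       (auto intro!: measurable_compose[OF _ \<phi>(1)])
  with step show ?case by simp
qed simp

lemma integral_initial_state:
  assumes "h + m \<le> horizon M"
  shows "(\<integral>\<omega>. \<phi> (\<omega> h) \<partial>traj_from M \<pi> h s m) = \<phi> s"
proof -
  have "(\<integral>\<omega>. \<phi> (\<omega> h) \<partial>traj_from M \<pi> h s m) = (\<integral>\<omega>. \<phi> (\<omega> h) \<partial>traj_from M \<pi> h s 0)"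
    using assms by (intro integral_earlier_state) auto
  also have "\<dots> = \<phi> s"
    by (simp, subst integral_return)
       (auto simp: space_PiM intro!: measurable_compose[OF _ \<phi>(1)] measurable_component_singleton)
  finally show ?thesis .
qed

lemma transition_mean_measurable:
  assumes t: "t \<in> {1..horizon M}"
  shows "(\<lambda>x. \<integral>s'. \<phi> s' \<partial>trans M t x) \<in> borel_measurable (states M \<Otimes>\<^sub>M actions M)"
  by (intro measurable_compose[OF measurable_prob_algebraD[OF trans_measurable[OF t]]]
      integral_measurable_subprob_algebra \<phi>)

lemma integrable_trans:
  assumes t: "t \<in> {1..horizon M}"
  shows "integrable (trans M t x) \<phi>"
proof -
  interpret prob_space "trans M t x" by (rule prob_space_trans[OF t])
  show ?thesis
    using \<phi>(2) by (intro integrable_const_bound[of _ c] AE_I2)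
      (auto intro!: \<phi>(1) simp: measurable_cong_sets[OF sets_trans[OF t] refl])
qed

lemma transition_mean_bounded:
  assumes t: "t \<in> {1..horizon M}"
  shows "\<bar>\<integral>s'. \<phi> s' \<partial>trans M t x\<bar> \<le> c"
proof -
  interpret prob_space "trans M t x" by (rule prob_space_trans[OF t])
  have "\<bar>\<integral>s'. \<phi> s' \<partial>trans M t x\<bar> \<le> (\<integral>s'. \<bar>\<phi> s'\<bar> \<partial>trans M t x)"
    by (rule integral_abs_bound)
  also have "\<dots> \<le> (\<integral>s'. c \<partial>trans M t x)"
    using \<phi>(2) integrable_trans[OF t] by (intro integral_mono) auto
  finally show ?thesis by (simp add: prob_space)
qed

end

text \<open>Markov property under the law of the full path: cut the path after step t + 1, integrate
  out its last state, then lengthen the path again.\<close>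

lemma integral_next_state:
  fixes \<phi> :: "'s \<Rightarrow> real"
  assumes \<phi>: "\<phi> \<in> borel_measurable (states M)" "\<And>s. \<bar>\<phi> s\<bar> \<le> c"
    and m: "h + m \<le> horizon M" and t: "h \<le> t" "t < h + m"
  shows "(\<integral>\<omega>. \<phi> (\<omega> (Suc t)) \<partial>traj_from M \<pi> h s m) =
         (\<integral>\<omega>. \<integral>s'. \<phi> s' \<partial>trans M t (\<omega> t, \<pi> t (\<omega> t)) \<partial>traj_from M \<pi> h s m)"
proof -
  obtain n where n: "t = h + n" using t le_Suc_ex by blast
  have tH: "t \<in> {1..horizon M}" using t m h by auto
  have [measurable]: "\<pi> t \<in> states M \<rightarrow>\<^sub>M actions M"
    by (rule policy_measurable[OF tH])
  have mean: "(\<lambda>s. \<integral>s'. \<phi> s' \<partial>trans M t (s, \<pi> t s)) \<in> borel_measurable (states M)"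
    by (rule measurable_compose[OF _ transition_mean_measurable[OF \<phi> tH]]) measurable
  have "(\<integral>\<omega>. \<phi> (\<omega> (Suc t)) \<partial>traj_from M \<pi> h s m)
      = (\<integral>\<omega>. \<phi> (\<omega> (Suc t)) \<partial>traj_from M \<pi> h s (Suc n))"
    using t m n by (intro integral_earlier_state[OF \<phi>]) auto
  also have "\<dots> = (\<integral>\<omega>. \<integral>s'. \<phi> s' \<partial>trans M t (\<omega> t, \<pi> t (\<omega> t)) \<partial>traj_from M \<pi> h s n)"
    using t m unfolding n by (intro integral_last_state[OF \<phi>]) auto
  also have "\<dots> = (\<integral>\<omega>. \<integral>s'. \<phi> s' \<partial>trans M t (\<omega> t, \<pi> t (\<omega> t)) \<partial>traj_from M \<pi> h s m)"
  \<comment> \<open>As the policy is deterministic, the transition mean is a function of the state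
    at step t alone. It is measurable and bounded by the same \<open>c\<close>, so consistency
    applies to it in place of \<open>\<phi>\<close>.\<close>
  proof (rule integral_earlier_state[symmetric])
    show "\<bar>\<integral>s'. \<phi> s' \<partial>trans M t (s, \<pi> t s)\<bar> \<le> c" for s
      by (rule transition_mean_bounded[OF \<phi> tH])
  qed (use mean t m n in auto)
  finally show ?thesis .
qed

end

section \<open>Greedy values and telescoping of Bellman residuals\<close>

lemma Vf_greedy:
  assumes "greedy_policy M f \<pi>" "h \<in> {1..horizon M}"
  shows "Vf M f h s = Qf M f h (s, \<pi> h s)"
  unfolding Vf_def using assms by (intro cSup_eq_maximum) (auto simp: greedy_policy_def)

lemma Vf_beyond_horizon: "horizon M < h \<Longrightarrow> Vf M f h s = 0"
  by (simp add: Vf_def Qf_def)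

lemma residual_eq:
  assumes "h \<in> {1..horizon M}"
  shows "residual M h f x = f h x - reward M h x - (\<integral>s'. Vf M f (Suc h) s' \<partial>trans M h x)"
  using assms by (simp add: residual_def bellman_op_def Vf_def Qf_def)

text \<open>A supremum over uncountably many actions need not be measurable. Here it is attained
  along a measurable greedy policy, so up to the horizon \<open>Vf\<close> is a composition of
  measurable maps.\<close>

lemma Vf_measurable:
  assumes "greedy_policy M f \<pi>"
    and "\<And>t. t \<in> {1..horizon M} \<Longrightarrow> f t \<in> borel_measurable (states M \<Otimes>\<^sub>M actions M)" and "1 \<le> h"
  shows "Vf M f h \<in> borel_measurable (states M)"
proof (cases "h \<le> horizon M")
  case True
  with \<open>1 \<le> h\<close> have h: "h \<in> {1..horizon M}" by simp
  have [measurable]: "\<pi> h \<in> states M \<rightarrow>\<^sub>M actions M" "f h \<in> borel_measurable (states M \<Otimes>\<^sub>M actions M)"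
    using assms h by (auto simp: greedy_policy_def policies_def)
  have "Vf M f h = (\<lambda>s. f h (s, \<pi> h s))"
    using Vf_greedy[OF assms(1) h] True by (auto simp: Qf_def)
  then show ?thesis by simp
next
  case False
  then have "Vf M f h = (\<lambda>_. 0)" by (auto simp: Vf_beyond_horizon)
  then show ?thesis by simp
qed

text \<open>Under the greedy policy the mean residual at step t is e(t) - r(t) - e(t+1), where e(t)
  is the mean predicted value of the t-th state and r(t) the mean reward; the sum telescopes. The
  integrability claim serves to pass to absolute values in the dominance property.\<close>

lemma value_difference_eq_sum_residual:
  fixes M :: "('s, 'a) mdp"
  assumes mdp: "episodic_mdp M" and greedy: "greedy_policy M f \<pi>"
    and meas: "\<And>t. t \<in> {1..horizon M} \<Longrightarrow> f t \<in> borel_measurable (states M \<Otimes>\<^sub>M actions M)"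
    and bnd: "\<And>t. t \<in> {1..horizon M} \<Longrightarrow> bounded (range (f t))"
  shows "Vf M f 1 (init M) - value_pi M \<pi> 1 (init M)
       = (\<Sum>h=1..horizon M. expect_pi M \<pi> h (residual M h f))"
    and "h \<in> {1..horizon M} \<Longrightarrow>
           integrable (traj M \<pi>) (\<lambda>\<omega>. residual M h f (\<omega> h, \<pi> h (\<omega> h)))"
proof -
  let ?H = "horizon M"
  let ?\<mu> = "traj M \<pi>"
  let ?V = "Vf M f"
  have H: "1 \<le> ?H" using mdp by (simp add: episodic_mdp_def)
  have pol: "\<pi> \<in> policies M" using greedy by (simp add: greedy_policy_def)
  have H1: "1 + (?H - 1) \<le> ?H" using H by simp
  interpret \<mu>: prob_space ?\<mu>
    unfolding traj_def by (rule prob_space_traj_from[OF mdp pol _ H1]) simp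
  have state[measurable]: "(\<lambda>\<omega>. \<omega> t) \<in> ?\<mu> \<rightarrow>\<^sub>M states M" if "t \<in> {1..?H}" for t
    unfolding traj_def by (rule state_measurable[OF mdp pol _ H1]) (use that in auto)
  have V_meas: "?V t \<in> borel_measurable (states M)" if "1 \<le> t" for t
    by (rule Vf_measurable[OF greedy meas that])
  have "bounded (\<Union>t\<in>{1..?H}. range (f t))"
    using bnd by (intro bounded_UN) auto
  then obtain B where bnd: "\<And>t x. t \<in> {1..?H} \<Longrightarrow> \<bar>f t x\<bar> \<le> B"
    unfolding bounded_iff real_norm_def by blast
  have B0: "0 \<le> B" using bnd[of 1 undefined] H by fastforce
  have V_bnd: "\<bar>?V t s\<bar> \<le> B" if "1 \<le> t" for t s
    using bnd[of t "(s, \<pi> t s)"] Vf_greedy[OF greedy, of t s] Vf_beyond_horizon[of M t f s] that B0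
    by (cases "t \<le> ?H") (auto simp: Qf_def)
  have int: "integrable ?\<mu> (\<lambda>\<omega>. g (\<omega> t, \<pi> t (\<omega> t)))"
    if t: "t \<in> {1..?H}" and g[measurable]: "g \<in> borel_measurable (states M \<Otimes>\<^sub>M actions M)"
      and c: "\<And>x. \<bar>g x\<bar> \<le> c" for g :: "'s \<times> 'a \<Rightarrow> real" and t c
  proof -
    have [measurable]: "\<pi> t \<in> states M \<rightarrow>\<^sub>M actions M" "(\<lambda>\<omega>. \<omega> t) \<in> ?\<mu> \<rightarrow>\<^sub>M states M"
      using policy_measurable[OF mdp pol _ t, of 1] state[OF t] by auto
    show ?thesis using c by (intro \<mu>.integrable_const_bound[of _ c] AE_I2) auto
  qed
  define r where "r t = (\<integral>\<omega>. reward M t (\<omega> t, \<pi> t (\<omega> t)) \<partial>?\<mu>)" for t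
  \<comment> \<open>A path has no coordinate H + 1, so the value 0 there is set by hand, in
    accordance with \<open>Vf\<close> being zero beyond the horizon.\<close>
  define e where "e t = (if t \<le> ?H then \<integral>\<omega>. ?V t (\<omega> t) \<partial>?\<mu> else 0)" for t
  have r_int: "integrable ?\<mu> (\<lambda>\<omega>. reward M t (\<omega> t, \<pi> t (\<omega> t)))" if t: "t \<in> {1..?H}" for t
  proof -
    have "bounded (range (reward M t))" and m: "reward M t \<in> borel_measurable (states M \<Otimes>\<^sub>M actions M)"
      using mdp t by (auto simp: episodic_mdp_def)
    then obtain c where "\<And>x. \<bar>reward M t x\<bar> \<le> c" by (auto simp: bounded_iff)
    with int[OF t m] show ?thesis by blast
  qed
  have f_int: "integrable ?\<mu> (\<lambda>\<omega>. f t (\<omega> t, \<pi> t (\<omega> t)))" if t: "t \<in> {1..?H}" for t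
    by (rule int[OF t meas[OF t] bnd[OF t]])
  have P_int: "integrable ?\<mu> (\<lambda>\<omega>. \<integral>s'. ?V (Suc t) s' \<partial>trans M t (\<omega> t, \<pi> t (\<omega> t)))"
    if t: "t \<in> {1..?H}" for t
  proof (rule int[OF t, of "\<lambda>x. \<integral>s'. ?V (Suc t) s' \<partial>trans M t x" B])
    show "(\<lambda>x. \<integral>s'. ?V (Suc t) s' \<partial>trans M t x) \<in> borel_measurable (states M \<Otimes>\<^sub>M actions M)"
      by (rule transition_mean_measurable[OF mdp pol _ V_meas V_bnd t]) auto
    show "\<bar>\<integral>s'. ?V (Suc t) s' \<partial>trans M t x\<bar> \<le> B" for x
      by (rule transition_mean_bounded[OF mdp pol _ V_meas V_bnd t]) auto
  qed
  show "integrable ?\<mu> (\<lambda>\<omega>. residual M h f (\<omega> h, \<pi> h (\<omega> h)))" if t: "h \<in> {1..?H}" for h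
    unfolding residual_eq[OF t]
    by (intro Bochner_Integration.integrable_diff f_int r_int P_int t)
  have step: "expect_pi M \<pi> t (residual M t f) = e t - r t - e (Suc t)" if t: "t \<in> {1..?H}" for t
  proof -
    have "expect_pi M \<pi> t (residual M t f)
        = (\<integral>\<omega>. f t (\<omega> t, \<pi> t (\<omega> t)) \<partial>?\<mu>) - r t
          - (\<integral>\<omega>. \<integral>s'. ?V (Suc t) s' \<partial>trans M t (\<omega> t, \<pi> t (\<omega> t)) \<partial>?\<mu>)"
      unfolding expect_pi_def residual_eq[OF t] r_def
      by (simp add: f_int[OF t] r_int[OF t] P_int[OF t])
    also have "(\<integral>\<omega>. f t (\<omega> t, \<pi> t (\<omega> t)) \<partial>?\<mu>) = e t"
      using t by (simp add: e_def Vf_greedy[OF greedy t] Qf_def)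
    also have "(\<integral>\<omega>. \<integral>s'. ?V (Suc t) s' \<partial>trans M t (\<omega> t, \<pi> t (\<omega> t)) \<partial>?\<mu>) = e (Suc t)"
    \<comment> \<open>At the last step the next value function vanishes; before it, the Markov
      property turns the transition mean into the mean at the next state.\<close>
    proof (cases "t = ?H")
      case True
      then show ?thesis by (simp add: e_def Vf_beyond_horizon)
    next
      case False
      have "(\<integral>\<omega>. ?V (Suc t) (\<omega> (Suc t)) \<partial>?\<mu>)
          = (\<integral>\<omega>. \<integral>s'. ?V (Suc t) s' \<partial>trans M t (\<omega> t, \<pi> t (\<omega> t)) \<partial>?\<mu>)"
        unfolding traj_def
        by (rule integral_next_state[OF mdp pol _ V_meas V_bnd H1]) (use t False in auto)
      then show ?thesis using t False by (simp add: e_def)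
    qed
    finally show ?thesis .
  qed
  have "e 1 = ?V 1 (init M)"
    using H unfolding e_def traj_def
    by (simp add: integral_initial_state[OF mdp pol _ V_meas V_bnd H1, simplified])
  moreover have "value_pi M \<pi> 1 (init M) = (\<Sum>t=1..?H. r t)"
    unfolding value_pi_def r_def traj_def[symmetric]
    by (intro Bochner_Integration.integral_sum r_int)
  moreover have "(\<Sum>t=1..?H. e t - r t - e (Suc t)) = e 1 - e (Suc ?H) - (\<Sum>t=1..?H. r t)"
    using H sum_Suc_diff[of 1 "Suc ?H" "\<lambda>t. - e t"]
    by (simp add: sum_subtractf sum.distrib algebra_simps atLeastLessThanSuc_atLeastAtMost sum_negf)
  moreover have "e (Suc ?H) = 0" by (simp add: e_def)
  ultimately show "?V 1 (init M) - value_pi M \<pi> 1 (init M)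
       = (\<Sum>h=1..?H. expect_pi M \<pi> h (residual M h f))"
    using step by simp
qed

section \<open>Verification of the EC conditions for the Bellman loss\<close>

text \<open>Two degenerate cases are excluded because the right-hand side would be 0. For K = 1 the
  logarithm vanishes. For d = 0 the dimension only gives residuals of size at most
  \<open>1 / sqrt K\<close>, whose squares may still add up to 1; hence residuals are assumed to be
  zero then.\<close>

theorem lemmaD2:
  fixes M :: "('s, 'a) mdp"
    and Fh Gh :: "nat \<Rightarrow> ('s \<times> 'a \<Rightarrow> real) set"
    and F G :: "('s, 'a) hyp set"
    and pol :: "('s, 'a) hyp \<Rightarrow> ('s, 'a) policy"
    and K d :: nat
    and \<Omega> :: "'w measure"
  assumes mdp: "episodic_mdp M"
    and F_def: "F = prod_class M Fh" and G_def: "G = prod_class M Gh"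
    and meas: "\<And>h. h \<in> {1..horizon M} \<Longrightarrow>
                 Fh h \<subseteq> borel_measurable (states M \<Otimes>\<^sub>M actions M)"
    and sub: "F \<subseteq> G"
    and real: "realizable M F"
    and compl: "complete_class M F Gh"
    and greedy: "\<And>f. f \<in> F \<Longrightarrow> greedy_policy M f (pol f)"
    and loss_bound: "\<And>h f' f g x s'. \<lbrakk>h \<in> {1..horizon M}; f' \<in> F; f \<in> F; g \<in> G\<rbrakk> \<Longrightarrow>
                       \<bar>bellman_loss M h f' s' x f g\<bar> \<le> 3"
    and K: "2 \<le> K"
    and dim: "bellman_eluder_dim M F (1 / sqrt (real K)) = enat d"
    and nondegenerate: "\<And>h f x. \<lbrakk>d = 0; h \<in> {1..horizon M}; f \<in> F\<rbrakk> \<Longrightarrow> residual M h f x = 0"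
    and prob: "prob_space \<Omega>"
  shows "l2_EC_class 10 \<Omega> K 3 pol M F G (bellman_loss M) (real d) 1
    \<and> (\<forall>h\<in>{1..horizon M}. \<forall>\<beta>\<ge>9. \<forall>f x.
         (\<forall>i\<in>{1..K}. f i \<in> F) \<longrightarrow>
         (\<forall>k\<in>{1..K}. (\<Sum>i\<in>{1..<k}. (residual M h (f k) (x i))\<^sup>2) \<le> \<beta>) \<longrightarrow>
         (\<forall>k\<in>{1..K}. (\<Sum>i=1..k. (residual M h (f i) (x i))\<^sup>2)
            \<le> 10 * (real d * \<beta> * ln (real K))))
    \<and> kappa_dominance \<Omega> K M F pol (bellman_loss M) 1"
proof -
  let ?H = "horizon M"
  let ?l = "bellman_loss M"
  have pol: "pol f \<in> policies M" if "f \<in> F" for f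
    using greedy[OF that] by (simp add: greedy_policy_def)
  have f_meas: "f t \<in> borel_measurable (states M \<Otimes>\<^sub>M actions M)"
    if "f \<in> F" "t \<in> {1..?H}" for f t
    using that meas[OF that(2)] by (auto simp: F_def prod_class_def)
  have V_meas: "Vf M f (Suc t) \<in> borel_measurable (states M)" if "f \<in> F" for f t
    by (rule Vf_measurable[OF greedy[OF that] f_meas[OF that]]) auto
  have V_int: "integrable (trans M h x) (Vf M f (Suc h))" if "f \<in> F" "h \<in> {1..?H}" for f h x
  proof (rule integrable_trans[OF mdp pol[OF that(1)] order_refl V_meas[OF that(1)] _ that(2)])
    \<comment> \<open>The loss at f = g is Q - r - V. With the pair x fixed, its bound 3 yields a
      bound on V that is uniform in the next state.\<close>
    show "\<bar>Vf M f (Suc h) s\<bar> \<le> 3 + \<bar>Qf M f h x - reward M h x\<bar>" for s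
      using loss_bound[of h f f f s x] that sub by (auto simp: bellman_loss_def)
  qed
  have mean: "mean_loss M ?l h f' x f f = residual M h f x" if "f \<in> F" "h \<in> {1..?H}" for f f' h x
  proof -
    interpret prob_space "trans M h x"
      by (rule prob_space_trans[OF mdp pol[OF that(1)] order_refl that(2)])
    show ?thesis
      unfolding mean_loss_def bellman_loss_def using V_int[OF that, of x] that(2)
      by (simp add: residual_eq prob_space Qf_def)
  qed
  have res_bnd: "\<bar>residual M h f x\<bar> \<le> 3" if "f \<in> F" "h \<in> {1..?H}" for f h x
  proof -
    interpret prob_space "trans M h x"
      by (rule prob_space_trans[OF mdp pol[OF that(1)] order_refl that(2)])
    have "\<bar>residual M h f x\<bar> \<le> (\<integral>s'. \<bar>?l h f s' x f f\<bar> \<partial>trans M h x)"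
      unfolding mean[OF that, of f x, symmetric] mean_loss_def by (rule integral_abs_bound)
    also have "\<dots> \<le> (\<integral>s'. 3 \<partial>trans M h x)"
    proof (rule integral_mono)
      show "\<bar>?l h f s' x f f\<bar> \<le> 3" for s'
        using that sub by (intro loss_bound) auto
      show "integrable (trans M h x) (\<lambda>s'. \<bar>?l h f s' x f f\<bar>)"
        using V_int[OF that, of x] by (simp add: bellman_loss_def)
    qed simp
    finally show ?thesis by (simp add: prob_space)
  qed
  \<comment> \<open>Now the next state is fixed instead, at an arbitrary point: the bounds on the
    loss and the reward then bound \<open>f t\<close> uniformly over all pairs.\<close>
  have f_bnd: "bounded (range (f t))" if "f \<in> F" "t \<in> {1..?H}" for f t
  proof -
    have "bounded (range (reward M t))" using mdp that by (auto simp: episodic_mdp_def)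
    then obtain c where c: "\<And>x. \<bar>reward M t x\<bar> \<le> c" by (auto simp: bounded_iff)
    have "\<bar>f t x\<bar> \<le> 3 + c + \<bar>Vf M f (Suc t) undefined\<bar>" for x
      using loss_bound[of t f f f undefined x] c[of x] that sub
      by (auto simp: bellman_loss_def Qf_def subset_iff)
    then show ?thesis by (auto simp: bounded_iff)
  qed
  have gen: "(\<Sum>i=1..k. (residual M h (f i) (x i))\<^sup>2) \<le> 10 * (real d * \<beta> * ln (real K))"
    if h: "h \<in> {1..?H}" and \<beta>: "9 \<le> \<beta>" and fF: "\<forall>i\<in>{1..K}. f i \<in> F"
      and small: "\<forall>k\<in>{1..K}. (\<Sum>i\<in>{1..<k}. (residual M h (f k) (x i))\<^sup>2) \<le> \<beta>"
      and k: "k \<in> {1..K}" for h \<beta> f x k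
  proof (cases "d = 0")
    case True
    then show ?thesis using nondegenerate[OF True h] fF k by simp
  next
    case False
    show ?thesis
      by (rule sum_residual_square_le[where F = F and B = 3, OF eq_refl[OF dim] h K])
         (use False \<beta> fF small k res_bnd[OF _ h] in auto)
  qed
  have dom: "kappa_dominance \<Omega> K M F pol ?l 1"
    unfolding kappa_dominance_def
  \<comment> \<open>The inequality holds for every outcome, so the event is the whole space, of
    probability 1 \<ge> 1 - \<delta>.\<close>
  proof (intro allI impI ballI bexI[of _ "space \<Omega>"] conjI)
    fix f :: "nat \<Rightarrow> 'w \<Rightarrow> ('s, 'a) hyp" and k \<omega> \<delta>
    assume fF: "\<forall>i\<in>{1..K}. \<forall>\<omega>\<in>space \<Omega>. f i \<omega> \<in> F" and k: "k \<in> {1..K}" and \<omega>: "\<omega> \<in> space \<Omega>"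
    have "Vf M (f i \<omega>) 1 (init M) - value_pi M (pol (f i \<omega>)) 1 (init M)
        \<le> (\<Sum>h=1..?H. expect_pi M (pol (f i \<omega>)) h
              (\<lambda>x. norm (mean_loss M ?l h (f i \<omega>) x (f i \<omega>) (f i \<omega>))))" if "i \<in> {1..k}" for i
    proof -
      have F: "f i \<omega> \<in> F" using fF k \<omega> that by auto
      have diff: "Vf M (f i \<omega>) 1 (init M) - value_pi M (pol (f i \<omega>)) 1 (init M)
          = (\<Sum>h=1..?H. expect_pi M (pol (f i \<omega>)) h (residual M h (f i \<omega>)))"
        using f_meas[OF F] f_bnd[OF F] by (rule value_difference_eq_sum_residual(1)[OF mdp greedy[OF F]])
      show ?thesis
        unfolding diff
      proof (rule sum_mono)
        fix h assume h: "h \<in> {1..?H}"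
        show "expect_pi M (pol (f i \<omega>)) h (residual M h (f i \<omega>)) \<le> expect_pi M (pol (f i \<omega>)) h
              (\<lambda>x. norm (mean_loss M ?l h (f i \<omega>) x (f i \<omega>) (f i \<omega>)))"
          \<comment> \<open>The mean loss is the residual itself, so what remains is that the
            expectation of an integrable function is at most that of its absolute value.\<close>
          unfolding expect_pi_def mean[OF F h] real_norm_def
          using value_difference_eq_sum_residual(2)[OF mdp greedy[OF F] f_meas[OF F] f_bnd[OF F] h]
          by (intro integral_mono integrable_abs) auto
      qed
    qed
    then have "(\<Sum>i=1..k. Vf M (f i \<omega>) 1 (init M) - value_pi M (pol (f i \<omega>)) 1 (init M))
        \<le> (\<Sum>i=1..k. \<Sum>h=1..?H. expect_pi M (pol (f i \<omega>)) h
              (\<lambda>x. norm (mean_loss M ?l h (f i \<omega>) x (f i \<omega>) (f i \<omega>))))"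
      by (rule sum_mono)
    also have "\<dots> = 1 * (\<Sum>h=1..?H. \<Sum>i=1..k. expect_pi M (pol (f i \<omega>)) h
              (\<lambda>x. norm (mean_loss M ?l h (f i \<omega>) x (f i \<omega>) (f i \<omega>))))"
      by (subst sum.swap) simp
    finally show "(\<Sum>i=1..k. Vf M (f i \<omega>) 1 (init M) - value_pi M (pol (f i \<omega>)) 1 (init M))
        \<le> 1 * (\<Sum>h=1..?H. \<Sum>i=1..k. expect_pi M (pol (f i \<omega>)) h
              (\<lambda>x. norm (mean_loss M ?l h (f i \<omega>) x (f i \<omega>) (f i \<omega>))))" .
  next
    fix \<delta> :: real assume "\<delta> \<in> {0<..<1}"
    then show "1 - \<delta> \<le> measure \<Omega> (space \<Omega>)"
      using prob_space.prob_space[OF prob] by simp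
  qed simp
  have loss: "(\<lambda>s'. ?l h f' s' x f g) \<in> borel_measurable (states M) \<and> (\<forall>s'. norm (?l h f' s' x f g) \<le> 3)"
    if "h \<in> {1..?H}" "f' \<in> F" "f \<in> F" "g \<in> G" for h f' f g x
    using loss_bound[OF that] V_meas[OF that(3)] by (simp add: bellman_loss_def)
  have "ec_generalization 10 K 3 M F ?l (real d)"
    unfolding ec_generalization_def
  proof (intro allI ballI impI)
    fix \<beta> h f x k
    assume \<beta>: "(3::real)\<^sup>2 \<le> \<beta>" and h: "h \<in> {1..?H}" and fF: "\<forall>i\<in>{1..K}. f i \<in> F" and k: "k \<in> {1..K}"
      and small: "\<forall>k\<in>{1..K}. (\<Sum>i\<in>{1..<k}. (norm (mean_loss M ?l h (f i) (x i) (f k) (f k)))\<^sup>2) \<le> \<beta>"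
    have "(\<Sum>i=1..k. (residual M h (f i) (x i))\<^sup>2) \<le> 10 * (real d * \<beta> * ln (real K))"
      using \<beta> small fF mean[OF _ h] by (intro gen h k fF) auto
    then show "(\<Sum>i=1..k. (norm (mean_loss M ?l h (f i) (x i) (f i) (f i)))\<^sup>2)
        \<le> 10 * (real d * \<beta> * ln (real K))"
      using fF k mean[OF _ h] by (simp cong: sum.cong_simp)
  qed
  with sub real loss dom have "l2_EC_class 10 \<Omega> K 3 pol M F G ?l (real d) 1"
    unfolding l2_EC_class_def by blast
  with gen dom show ?thesis by blast
qed

end
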